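(* Let $0<\delta<1$, let $\Omega\subseteq S^2$ with $|\partial\Omega|=0$, and let $f\in L^1(\bar\Omega)$ with $f>0$ a.e. Let $g_1,\dots,g_N$ be positive numbers with $N>1$, and let $\Omega^*=\{m_1,\dots,m_N\}\subseteq S^2$ be a set of $N$ distinct points such that $x\cdot m_i\le 1-\delta$ for all $x\in\bar\Omega$ and $1\le i\le N$. Define $\eta=\sum_{i=1}^N g_i\,\delta_{m_i}$ on $\Omega^*$. Fix $a>0$ and $a'\ge\frac{4a}{\delta}$, and suppose that $$\int_{\bar\Omega}f(x)\,dx\ \ge\ \frac{1}{C(a',\delta)}\,\eta(\Omega^* ),\qquad C(a',\delta)=\frac{\delta^3}{2a'^2}.$$ Then there exists $\bar w=(a',\bar d_2,\dots,\bar d_N)$ (write $\bar d_1=a'$) with $\bar d_i\ge 2a$ for $1\le i\le N$ such that the far field reflector $\bar\sigma=\{\rho_{\bar w}(x)x\}_{x\in\bar\Omega}$ and its reflector measure $\bar\mu=\mu_{\bar w}$ satisfy: (1) $\bar\Omega=\bigcup_{i=1}^N\tau_{\bar\sigma}(m_i)$; (2) $\bar\mu(m_i)=g_i$ for $2\le i\le N$; (3) $\bar\mu(m_1)>g_1$.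
   Context: $S^2$ is the unit sphere of $\mathbb{R}^3$ centered at the origin $O$; $dx$ and $|\cdot|$ denote surface (Lebesgue) measure on $S^2$; $\bar\Omega$, $\partial\Omega$ are closure and boundary in $S^2$. For $m\in S^2$ and $d>0$, $P_d(m)$ is the paraboloid of revolution with focus $O$, axis direction $m$ and polar radius $\rho_d(x)=\frac{d}{1-x\cdot m}$, $x\in S^2\setminus\{m\}$. For $w=(d_1,\dots,d_N)$ with $d_i>0$, $\rho_w(x)=\min_{1\le i\le N}\frac{d_i}{1-x\cdot m_i}$ and $\sigma_w=\{\rho_w(x)x\}_{x\in\bar\Omega}$. For $m\in\Omega^*$, $\tau_{\sigma_w}(m)$ is the set of $x_0\in\bar\Omega$ such that some paraboloid $P_d(m)$ supports $\sigma_w$ at $\rho_w(x_0)x_0$, i.e. $\rho_w(x)\le\rho_d(x)$ for all $x\in\bar\Omega$ with equality at $x=x_0$; $\tau_{\sigma_w}(E)=\bigcup_{m\in E}\tau_{\sigma_w}(m)$. The reflector measure is $$\mu_w(E)=\int_{\tau_{\sigma_w}(E)}f(x)\,\frac{x\cdot\nu_w(x)}{\rho_w(x)^2}\,dx,\qquad E\subseteq\Omega^*,$$ where $\nu_w(x)$ is the outer unit normal to $\sigma_w$ at $\rho_w(x)x$ (defined for a.e. $x$; a.e. it equals $\frac{x-m}{|x-m|}$ with $P_d(m)$ the supporting paraboloid at that point). $\mu_w(m_i)$ means $\mu_w(\{m_i\})$. *)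

theory Defs
  imports "HOL-Analysis.Analysis"
begin

abbreviation S2 :: "(real^3) set" where
  "S2 \<equiv> sphere 0 1"

abbreviation S2_closure :: "(real^3) set \<Rightarrow> (real^3) set" where
  "S2_closure \<Omega> \<equiv> (top_of_set S2) closure_of \<Omega>"

abbreviation S2_boundary :: "(real^3) set \<Rightarrow> (real^3) set" where
  "S2_boundary \<Omega> \<equiv> (top_of_set S2) frontier_of \<Omega>"

text \<open>
  Surface measure on the unit sphere, in the usual polar-coordinate form: the area of \<open>E\<close> is
  three times the volume of the cone \<open>{t x | 0 < t \<le> 1, x \<in> E}\<close>, i.e. of the set of all \<open>y\<close> in the
  punctured unit ball with \<open>y / |y| \<in> E\<close>. The completion makes all subsets of null sets
  measurable, so that functions defined only almost everywhere can be integrated.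
\<close>
definition surface_measure :: "(real^3) measure" where
  "surface_measure =
     completion (scale_measure 3
       (distr (restrict_space lborel (cball 0 1 - {0})) (restrict_space borel S2)
          (\<lambda>y. y /\<^sub>R norm y)))"

lemma space_surface_measure: "space surface_measure = S2"
  by (simp add: surface_measure_def space_scale_measure space_restrict_space)

lemma direction_measurable:
  "(\<lambda>y::real^3. y /\<^sub>R norm y)
     \<in> restrict_space lborel (cball 0 1 - {0}) \<rightarrow>\<^sub>M restrict_space borel S2"
proof (rule measurable_restrict_space2)
  show "(\<lambda>y::real^3. y /\<^sub>R norm y)
      \<in> space (restrict_space lborel (cball 0 1 - {0})) \<rightarrow> S2"
    by (auto simp: space_restrict_space)
  show "(\<lambda>y::real^3. y /\<^sub>R norm y) \<in> borel_measurable (restrict_space lborel (cball 0 1 - {0}))"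
    by (rule measurable_restrict_space1) simp
qed

lemma emeasure_surface_measure_S2: "emeasure surface_measure S2 = ennreal (4 * pi)"
proof -
  let ?R = "restrict_space lborel (cball (0::real^3) 1 - {0})"
  let ?D = "distr ?R (restrict_space borel S2) (\<lambda>y. y /\<^sub>R norm y)"
  have S: "S2 \<in> sets (restrict_space borel S2)"
    by (simp add: sets_restrict_space_iff)
  have "emeasure ?D S2 = emeasure ?R ((\<lambda>y. y /\<^sub>R norm y) -` S2 \<inter> space ?R)"
    using direction_measurable S by (rule emeasure_distr)
  also have "(\<lambda>y. y /\<^sub>R norm y) -` S2 \<inter> space ?R = cball 0 1 - {0}"
    by (auto simp: space_restrict_space)
  also have "emeasure ?R (cball 0 1 - {0}) = emeasure lborel (cball (0::real^3) 1 - {0})"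
    by (rule emeasure_restrict_space) auto
  also have "\<dots> = emeasure lborel (cball (0::real^3) 1)"
    by (rule emeasure_Diff_null_set) auto
  also have "\<dots> = ennreal (unit_ball_vol 3)"
    using emeasure_cball[of 1 "0::real^3"] by simp
  also have "\<dots> = ennreal (4 / 3 * pi)"
    by (simp add: unit_ball_vol_3)
  finally have "emeasure (scale_measure 3 ?D) S2 = 3 * ennreal (4 / 3 * pi)"
    by simp
  also have "\<dots> = ennreal 3 * ennreal (4 / 3 * pi)"
    by simp
  also have "\<dots> = ennreal (4 * pi)"
    by (subst ennreal_mult[symmetric]) (auto simp del: ennreal_numeral)
  finally show ?thesis
    using S unfolding surface_measure_def by (subst emeasure_completion) auto
qed

definition weighted_dirac ::
  "nat \<Rightarrow> (nat \<Rightarrow> real) \<Rightarrow> (nat \<Rightarrow> 'a) \<Rightarrow> 'a measure" where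
  "weighted_dirac N g m =
     measure_of (m ` {1..N}) (Pow (m ` {1..N}))
       (\<lambda>E. \<Sum>i=1..N. ennreal (g i) * indicator E (m i))"

lemma emeasure_weighted_dirac:
  fixes m :: "nat \<Rightarrow> 'a"
  assumes "E \<subseteq> m ` {1..N}"
  shows "emeasure (weighted_dirac N g m) E = (\<Sum>i=1..N. ennreal (g i) * indicator E (m i))"
  unfolding weighted_dirac_def
proof (rule emeasure_measure_of_sigma)
  let ?\<mu> = "\<lambda>E :: 'a set. \<Sum>i=1..N. ennreal (g i) * indicator E (m i)"
  show "sigma_algebra (m ` {1..N}) (Pow (m ` {1..N}))"
    by (rule sigma_algebra_Pow)
  show "positive (Pow (m ` {1..N})) ?\<mu>"
    by (simp add: positive_def)
  show "countably_additive (Pow (m ` {1..N})) ?\<mu>"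
  proof (rule countably_additiveI)
    fix A :: "nat \<Rightarrow> 'a set" assume "disjoint_family A"
    have "(\<Sum>n. ?\<mu> (A n)) = (\<Sum>i=1..N. \<Sum>n. ennreal (g i) * indicator (A n) (m i))"
      by (rule suminf_sum) auto
    also have "\<dots> = ?\<mu> (\<Union> (range A))"
      by (intro sum.cong) (auto simp: suminf_indicator[OF \<open>disjoint_family A\<close>])
    finally show "(\<Sum>n. ?\<mu> (A n)) = ?\<mu> (\<Union> (range A))" .
  qed
  show "E \<in> Pow (m ` {1..N})" using assms by blast
qed

text \<open>
  Polar radius of the paraboloid of revolution with focus at the origin, axis direction \<open>m\<close> and
  parameter \<open>d\<close>.
\<close>
definition paraboloid_radius :: "real \<Rightarrow> real^3 \<Rightarrow> real^3 \<Rightarrow> real" where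
  "paraboloid_radius d m x = d / (1 - x \<bullet> m)"

text \<open>
  An \<open>N\<close>-tuple \<open>(d\<^sub>1, \<dots>, d\<^sub>N)\<close> is a function of which only the values on \<open>{1..N}\<close> are used.
\<close>
definition reflector_radius ::
  "nat \<Rightarrow> (nat \<Rightarrow> real^3) \<Rightarrow> (nat \<Rightarrow> real) \<Rightarrow> real^3 \<Rightarrow> real" where
  "reflector_radius N m w x = Min ((\<lambda>i. paraboloid_radius (w i) (m i) x) ` {1..N})"

definition radial_graph :: "(real^3) set \<Rightarrow> (real^3 \<Rightarrow> real) \<Rightarrow> (real^3) set" where
  "radial_graph \<Omega> \<rho> = (\<lambda>x. \<rho> x *\<^sub>R x) ` S2_closure \<Omega>"

definition paraboloid_supports ::
  "(real^3) set \<Rightarrow> (real^3 \<Rightarrow> real) \<Rightarrow> real \<Rightarrow> real^3 \<Rightarrow> real^3 \<Rightarrow> bool" where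
  "paraboloid_supports \<Omega> \<rho> d m x0 \<longleftrightarrow>
     (\<forall>x\<in>S2_closure \<Omega>. \<rho> x \<le> paraboloid_radius d m x) \<and>
     \<rho> x0 = paraboloid_radius d m x0"

definition tau :: "(real^3) set \<Rightarrow> (real^3 \<Rightarrow> real) \<Rightarrow> real^3 \<Rightarrow> (real^3) set" where
  "tau \<Omega> \<rho> m = {x0 \<in> S2_closure \<Omega>. \<exists>d>0. paraboloid_supports \<Omega> \<rho> d m x0}"

text \<open>
  \<open>\<nu>\<close> is a unit normal of the tangent plane of the surface \<open>\<sigma>\<close> at \<open>p\<close>, pointing away from the
  origin; this is the outward direction for a surface that is a radial graph.
\<close>
definition is_outer_unit_normal :: "(real^3) set \<Rightarrow> real^3 \<Rightarrow> real^3 \<Rightarrow> bool" where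
  "is_outer_unit_normal \<sigma> p \<nu> \<longleftrightarrow>
     norm \<nu> = 1 \<and> p \<bullet> \<nu> > 0 \<and>
     ((\<lambda>y. ((y - p) \<bullet> \<nu>) / norm (y - p)) \<longlongrightarrow> 0) (at p within \<sigma>)"

text \<open>
  The outer normal of the radial graph of \<open>\<rho>\<close>; a meaningful value only at the points where there is
  exactly one such normal. For a reflector over \<open>\<Omega>\<close> with \<open>|\<partial>\<Omega>| = 0\<close> these are almost all points of
  the closure of \<open>\<Omega>\<close>.
\<close>
definition outer_normal :: "(real^3) set \<Rightarrow> (real^3 \<Rightarrow> real) \<Rightarrow> real^3 \<Rightarrow> real^3" where
  "outer_normal \<Omega> \<rho> x = (THE \<nu>. is_outer_unit_normal (radial_graph \<Omega> \<rho>) (\<rho> x *\<^sub>R x) \<nu>)"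

definition reflector_measure ::
  "(real^3) set \<Rightarrow> (real^3 \<Rightarrow> real) \<Rightarrow> (real^3 \<Rightarrow> real) \<Rightarrow> (real^3) set \<Rightarrow> real" where
  "reflector_measure \<Omega> f \<rho> E =
     (LINT x:(\<Union>m\<in>E. tau \<Omega> \<rho> m)|surface_measure.
        f x * ((x \<bullet> outer_normal \<Omega> \<rho> x) / (\<rho> x)\<^sup>2))"

definition reflector_const :: "real \<Rightarrow> real \<Rightarrow> real" where
  "reflector_const a' \<delta> = \<delta> ^ 3 / (2 * a'\<^sup>2)"

end

(*
  With k_i(x) = (1 - x.m_i)^2 sqrt ((1 - x.m_i) / 2), the density of the reflector measure on the
  set where the i-th paraboloid realises rho_w is f k_i / w_i^2, up to the null set formed by the
  boundary of Omega and the circles on which two paraboloids meet. So mu_w(m_i) depends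
  continuously on w, and it decreases when another w_j is lowered. On all of the reflector the
  density is at least sqrt (delta / 2) delta^2 / a'^2 times f, which exceeds C(a', delta) f, so the
  total mass is larger than the sum of the g_i. Hence if mu_w(m_i) <= g_i for all i >= 2, then
  mu_w(m_1) > g_1; in particular the first paraboloid touches the reflector, which bounds every w_i
  from below by a' delta / 2 >= 2 a. A minimiser of the sum of the w_i among all such w then
  attains equality for i >= 2.
*)
theory Submission
  imports Defs
begin

section \<open>The surface measure\<close>

lemma continuous_on_S2_measurable:
  assumes "continuous_on S2 h"
  shows "h \<in> borel_measurable surface_measure"
proof -
  have "h \<in> borel_measurable (restrict_space borel S2)"
    using assms by (rule borel_measurable_continuous_on_restrict)
  then show ?thesis
    unfolding surface_measure_def by (intro measurable_completion) (simp cong: measurable_cong_sets)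
qed

lemma closed_in_S2_sets:
  assumes "closed A" "A \<subseteq> S2"
  shows "A \<in> sets surface_measure"
proof -
  have "A \<in> sets (restrict_space borel S2)"
    using assms by (auto simp: sets_restrict_space_iff)
  then show ?thesis
    unfolding surface_measure_def by (intro sets_completionI_sets) simp
qed

text \<open>The integrand of the reflector measure contains \<open>outer_normal\<close>, a
  \<open>THE\<close> term whose values on the exceptional null set are not controlled. Completeness
  of the surface measure turns a.e. agreement with a measurable function into measurability.\<close>

lemma borel_measurable_surface_AE_cong:
  assumes h: "h \<in> borel_measurable surface_measure"
    and ae: "AE x in surface_measure. k x = h x"
  shows "k \<in> borel_measurable surface_measure"
proof (rule measurableI)
  fix A :: "'a set" assume A: "A \<in> sets borel"
  interpret complete_measure surface_measure
    unfolding surface_measure_def by (rule completion.complete_measure_axioms)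
  show "k -` A \<inter> space surface_measure \<in> sets surface_measure"
  proof (rule in_sets_AE)
    show "h -` A \<inter> space surface_measure \<in> sets surface_measure"
      using h A by (rule measurable_sets)
    show "AE x in surface_measure. x \<in> h -` A \<inter> space surface_measure \<longleftrightarrow>
            x \<in> k -` A \<inter> space surface_measure"
      using ae by eventually_elim auto
  qed simp
qed simp

lemma surface_integral_cong_AE:
  fixes h k :: "real^3 \<Rightarrow> real"
  assumes h: "h \<in> borel_measurable surface_measure"
    and ae: "AE x in surface_measure. k x = h x"
  shows "integral\<^sup>L surface_measure k = integral\<^sup>L surface_measure h"
  using borel_measurable_surface_AE_cong[OF h ae] h ae by (rule integral_cong_AE)


text \<open>For c > 0 the cone lies in the frontier of the convex set c |y| \<le> v . y, and
  frontiers of convex sets are negligible. For c = 0 it is a hyperplane, and c < 0 reduces to c > 0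
  by changing both signs.\<close>

lemma negligible_circular_cone:
  fixes v :: "'a::euclidean_space"
  assumes "2 \<le> DIM('a)" and "v \<noteq> 0 \<or> c \<noteq> 0"
  shows "negligible {y. v \<bullet> y = c * norm y}"
proof -
  have pos: "negligible {y. v \<bullet> y = c * norm y}" if "c > 0" for v :: 'a and c
  proof -
    let ?C = "{y. c * norm y - v \<bullet> y \<le> 0}"
    have "convex ?C"
    proof (rule convexI)
      fix x y and s t :: real
      assume *: "x \<in> ?C" "y \<in> ?C" "0 \<le> s" "0 \<le> t" "s + t = 1"
      have "c * norm (s *\<^sub>R x + t *\<^sub>R y) \<le> c * (s * norm x + t * norm y)"
        using norm_triangle_ineq[of "s *\<^sub>R x" "t *\<^sub>R y"] * \<open>c > 0\<close> by (intro mult_left_mono) auto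
      also have "\<dots> = s * (c * norm x) + t * (c * norm y)"
        by (simp add: algebra_simps)
      also have "\<dots> \<le> s * (v \<bullet> x) + t * (v \<bullet> y)"
        using * by (intro add_mono mult_left_mono) auto
      finally show "s *\<^sub>R x + t *\<^sub>R y \<in> ?C"
        by (simp add: inner_add_right)
    qed
    have "y \<in> frontier ?C" if y: "v \<bullet> y = c * norm y" for y
    proof -
      have "y \<notin> interior ?C"
      proof
        assume "y \<in> interior ?C"
        then obtain e where e: "e > 0" "ball y e \<subseteq> ?C"
          by (meson mem_interior)
        \<comment> \<open>Move from y by a short z orthogonal to y. If y + z and y - z were both in
          \<open>?C\<close>, adding the two inequalities would cancel z on the linear side and give
          |y + z| + |y - z| \<le> 2 |y|, while by Pythagoras both norms exceed |y|.\<close>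
        obtain u where u: "u \<noteq> 0" "orthogonal y u"
          using orthogonal_to_vector_exists[OF assms(1)] .
        define z where "z = (e / 2 / norm u) *\<^sub>R u"
        have z: "norm z < e" "z \<noteq> 0" "y \<bullet> z = 0"
          using u e by (auto simp: z_def orthogonal_def)
        have "y + z \<in> ball y e" "y - z \<in> ball y e"
          using z by (auto simp: dist_norm)
        with e have "y + z \<in> ?C" "y - z \<in> ?C"
          by blast+
        then have "c * (norm (y + z) + norm (y - z)) \<le> 2 * (v \<bullet> y)"
          by (simp add: inner_add_right inner_diff_right algebra_simps)
        then have le: "norm (y + z) + norm (y - z) \<le> 2 * norm y"
          using y \<open>c > 0\<close> by simp
        have gt: "norm y < sqrt ((norm y)\<^sup>2 + (norm z)\<^sup>2)"
          using z by (intro real_less_rsqrt) simp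
        have "norm (y + z) = sqrt ((norm y)\<^sup>2 + (norm z)\<^sup>2)"
             "norm (y - z) = sqrt ((norm y)\<^sup>2 + (norm z)\<^sup>2)"
          using norm_add_Pythagorean[of y z] norm_add_Pythagorean[of y "- z"] z
          by (auto simp: orthogonal_def intro!: real_sqrt_unique[symmetric])
        with le gt show False by simp
      qed
      then show ?thesis
        using y closure_subset[of ?C] by (auto simp: frontier_def)
    qed
    then show ?thesis
      using negligible_convex_frontier[OF \<open>convex ?C\<close>] by (auto intro: negligible_subset)
  qed
  consider "c = 0" | "c > 0" | "c < 0" by linarith
  then show ?thesis
  proof cases
    case 1
    then show ?thesis using negligible_hyperplane[of v 0] assms by simp
  next
    case 2
    then show ?thesis by (rule pos)
  next
    case 3
    then have "negligible {y. (- v) \<bullet> y = (- c) * norm y}"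
      by (intro pos) simp
    then show ?thesis by simp
  qed
qed

text \<open>Under radial projection the preimage of the circle is a part of the cone v . y = c |y|,
  which is a Lebesgue null set.\<close>

lemma surface_null_circle:
  fixes v :: "real^3"
  assumes "v \<noteq> 0 \<or> c \<noteq> 0"
  shows "{x \<in> S2. v \<bullet> x = c} \<in> null_sets surface_measure"
proof -
  let ?R = "restrict_space lborel (cball (0::real^3) 1 - {0})"
  let ?D = "distr ?R (restrict_space borel S2) (\<lambda>y. y /\<^sub>R norm y)"
  let ?A = "{x \<in> S2. v \<bullet> x = c}" and ?B = "{y. v \<bullet> y = c * norm y} \<inter> (cball 0 1 - {0})"
  have A: "?A \<in> sets (restrict_space borel S2)"
    by (auto simp: sets_restrict_space_iff)
  have "?B \<in> sets borel" by simp
  have "negligible ?B"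
    using negligible_circular_cone[of v c] assms by (intro negligible_Int) auto
  then have "?B \<in> null_sets lborel"
    using \<open>?B \<in> sets borel\<close> by (simp add: negligible_iff_null_sets null_sets_completion_iff)
  then have "emeasure ?R ?B = 0"
    by (subst emeasure_restrict_space) auto
  moreover have "(\<lambda>y. y /\<^sub>R norm y) -` ?A \<inter> space ?R = ?B"
    by (auto simp: space_restrict_space field_simps)
  ultimately have "emeasure ?D ?A = 0"
    by (subst emeasure_distr[OF direction_measurable A]) simp
  then show ?thesis
    unfolding surface_measure_def using A
    by (intro null_sets_completionI) (auto simp: null_sets_def)
qed

section \<open>The normal of a paraboloid\<close>

text \<open>The paraboloid is the level set |y| - y . m = d, and x - m is the gradient of the left
  side at p. Subtracting the equations for y and p shows that (y - p) . (x - m) is a multiple of the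
  Cauchy-Schwarz defect |y| |p| - y . p, which is quadratic in |y - p|.\<close>

lemma is_outer_unit_normal_paraboloid:
  fixes x m :: "real^3"
  assumes "d > 0" "norm x = 1" "norm m = 1" "x \<bullet> m < 1"
    and U: "open U" "x \<in> U" "\<And>z. z \<in> U \<Longrightarrow> z \<in> S2_closure \<Omega> \<Longrightarrow> \<rho> z = paraboloid_radius d m z"
    and x: "\<rho> x = paraboloid_radius d m x"
    and pos: "\<And>z. z \<in> S2_closure \<Omega> \<Longrightarrow> \<rho> z > 0"
  shows "is_outer_unit_normal (radial_graph \<Omega> \<rho>) (\<rho> x *\<^sub>R x) ((x - m) /\<^sub>R norm (x - m))"
proof -
  define r where "r = \<rho> x"
  define p where "p = r *\<^sub>R x"
  define \<sigma> where "\<sigma> = radial_graph \<Omega> \<rho>"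
  have r: "r > 0" "r * (1 - x \<bullet> m) = d"
    using assms by (auto simp: r_def paraboloid_radius_def)
  have xx: "x \<bullet> x = 1" and mm: "m \<bullet> m = 1"
    using assms by (auto simp: dot_square_norm)
  have xm: "norm (x - m) > 0"
    using assms(4) xx by auto
  have p: "norm p = r" "p \<noteq> 0"
    using r assms by (auto simp: p_def)
  \<comment> \<open>Points of \<sigma> close to p have directions in U, where \<rho> is the radius
    of the paraboloid.\<close>
  have "((\<lambda>y. y /\<^sub>R norm y) \<longlongrightarrow> p /\<^sub>R norm p) (at p within \<sigma>)"
    using p by (intro tendsto_intros) auto
  moreover have "p /\<^sub>R norm p = x"
    using p r by (simp add: p_def)
  ultimately have "\<forall>\<^sub>F y in at p within \<sigma>. y /\<^sub>R norm y \<in> U"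
    using U(1,2) by (auto dest: topological_tendstoD)
  moreover have "\<forall>\<^sub>F y in at p within \<sigma>. y \<in> \<sigma> \<and> y \<noteq> p"
    by (simp add: eventually_at_filter)
  ultimately have "\<forall>\<^sub>F y in at p within \<sigma>.
      norm (((y - p) \<bullet> ((x - m) /\<^sub>R norm (x - m))) / norm (y - p)) \<le> norm (y - p) / (2 * r * norm (x - m))"
  proof eventually_elim
    case (elim y)
    then obtain z where z: "z \<in> S2_closure \<Omega>" "y = \<rho> z *\<^sub>R z"
      by (auto simp: \<sigma>_def radial_graph_def)
    have "norm z = 1"
      using z(1) closure_of_subset_topspace[of "top_of_set S2" \<Omega>] by auto
    then have y: "norm y = \<rho> z" "y /\<^sub>R norm y = z"
      using z pos[OF z(1)] by auto
    have \<rho>z: "\<rho> z = d / (1 - z \<bullet> m)"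
      using elim(1) U(3)[of z] z(1) unfolding y(2) by (simp add: paraboloid_radius_def)
    then have "1 - z \<bullet> m \<noteq> 0"
      using pos[OF z(1)] by auto
    then have "\<rho> z * (1 - z \<bullet> m) = d"
      using \<rho>z by simp
    then have "norm y - y \<bullet> m = d"
      using y(1) by (simp add: z(2) algebra_simps)
    moreover have "norm p - p \<bullet> m = d"
      using p r by (simp add: p_def algebra_simps)
    ultimately have ym: "(y - p) \<bullet> m = norm y - r"
      using p by (simp add: inner_diff_left)
    have "(y - p) \<bullet> (x - m) = (y \<bullet> p) / r - norm y"
      using ym xx r by (simp add: inner_diff_left inner_diff_right p_def field_simps)
    also have "\<dots> = - (norm y * norm p - y \<bullet> p) / r"
      using r p by (simp add: field_simps)
    finally have eq: "(y - p) \<bullet> (x - m) = - (norm y * norm p - y \<bullet> p) / r" .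
    have "norm y * norm p - y \<bullet> p \<ge> 0"
      using norm_cauchy_schwarz[of y p] by simp
    \<comment> \<open>Dropping the last square bounds the defect by |y - p|^2 / 2, so after division
      by |y - p| a term that tends to 0 remains.\<close>
    moreover have "2 * (norm y * norm p - y \<bullet> p) = (norm (y - p))\<^sup>2 - (norm y - norm p)\<^sup>2"
      using dot_norm_neg[of y p] by (simp add: power2_diff field_simps)
    then have "2 * (norm y * norm p - y \<bullet> p) \<le> (norm (y - p))\<^sup>2"
      by simp
    ultimately have "\<bar>(y - p) \<bullet> (x - m)\<bar> \<le> (norm (y - p))\<^sup>2 / (2 * r)"
      using r unfolding eq minus_divide_left[symmetric] abs_minus_cancel abs_divide
      by (simp add: pos_le_divide_eq)
    then have "\<bar>(y - p) \<bullet> (x - m)\<bar> / (norm (x - m) * norm (y - p))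
        \<le> (norm (y - p))\<^sup>2 / (2 * r) / (norm (x - m) * norm (y - p))"
      by (intro divide_right_mono) auto
    also have "\<dots> = norm (y - p) / (2 * r * norm (x - m))"
      using elim by (simp add: power2_eq_square)
    also have "\<bar>(y - p) \<bullet> (x - m)\<bar> / (norm (x - m) * norm (y - p)) =
        norm (((y - p) \<bullet> ((x - m) /\<^sub>R norm (x - m))) / norm (y - p))"
      unfolding real_norm_def inner_scaleR_right abs_divide abs_mult abs_inverse abs_norm_cancel
      by (simp only: divide_inverse inverse_mult_distrib mult_ac)
    finally show ?case .
  qed
  moreover have "((\<lambda>y. norm (y - p) / (2 * r * norm (x - m))) \<longlongrightarrow> norm (p - p) / (2 * r * norm (x - m)))
      (at p within \<sigma>)"
    using r xm by (intro tendsto_intros) auto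
  then have "((\<lambda>y. norm (y - p) / (2 * r * norm (x - m))) \<longlongrightarrow> 0) (at p within \<sigma>)"
    by simp
  ultimately have "((\<lambda>y. ((y - p) \<bullet> ((x - m) /\<^sub>R norm (x - m))) / norm (y - p)) \<longlongrightarrow> 0) (at p within \<sigma>)"
    by (rule Lim_null_comparison)
  moreover have "p \<bullet> (x - m) > 0"
    using r xx assms by (simp add: p_def inner_diff_right)
  ultimately show ?thesis
    using xm by (simp add: is_outer_unit_normal_def p_def r_def \<sigma>_def)
qed

text \<open>The curve is the tangent line p + s t projected radially back to the paraboloid |y| - y
  . m = d. The scaling factor is 1 at s = 0 and has derivative 0 there, because |y| - y . m is
  stationary in tangent directions; hence the velocity remains t.\<close>

lemma paraboloid_tangent_curve:
  fixes p t m :: "'a::real_inner"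
  assumes "p \<noteq> 0" "norm p - p \<bullet> m = d" "d \<noteq> 0" "t \<bullet> (p /\<^sub>R norm p - m) = 0"
  shows "((\<lambda>s. (d / (norm (p + s *\<^sub>R t) - (p + s *\<^sub>R t) \<bullet> m)) *\<^sub>R (p + s *\<^sub>R t))
           has_vector_derivative t) (at 0)"
proof -
  have "(norm has_derivative (\<lambda>h. h \<bullet> sgn p)) (at (p + 0 *\<^sub>R t))"
    using has_derivative_norm[of p] assms by (simp add: inner_commute)
  moreover have "((\<lambda>s. p + s *\<^sub>R t) has_derivative (\<lambda>s. s *\<^sub>R t)) (at (0::real))"
    by (auto intro!: derivative_eq_intros)
  ultimately have "((\<lambda>s. norm (p + s *\<^sub>R t)) has_derivative (\<lambda>s. (s *\<^sub>R t) \<bullet> sgn p)) (at 0)"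
    by (rule has_derivative_compose[rotated])
  then have n: "((\<lambda>s. norm (p + s *\<^sub>R t)) has_real_derivative t \<bullet> sgn p) (at 0)"
    by (simp add: has_field_derivative_def mult.commute[of _ "t \<bullet> sgn p"])
  have i: "((\<lambda>s. (p + s *\<^sub>R t) \<bullet> m) has_real_derivative t \<bullet> m) (at 0)"
    by (auto intro!: derivative_eq_intros simp: inner_add_left)
  have t: "t \<bullet> sgn p - t \<bullet> m = 0"
    using assms by (simp add: sgn_div_norm inner_diff_right)
  have "((\<lambda>s. norm (p + s *\<^sub>R t) - (p + s *\<^sub>R t) \<bullet> m) has_real_derivative 0) (at 0)"
    using DERIV_diff[OF n i] t by simp
  then have "((\<lambda>s. d / (norm (p + s *\<^sub>R t) - (p + s *\<^sub>R t) \<bullet> m)) has_real_derivative 0) (at 0)"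
    using DERIV_divide[OF DERIV_const[of d]] assms by fastforce
  moreover have "((\<lambda>s. p + s *\<^sub>R t) has_vector_derivative t) (at (0::real))"
    by (auto intro!: derivative_eq_intros)
  ultimately show ?thesis
    using has_vector_derivative_scaleR assms by fastforce
qed

text \<open>Existence is the preceding result on normals; the work is uniqueness, which gives the
  \<open>THE\<close> term its value. Every direction t orthogonal to x - m is the velocity of a
  curve in the radial graph, since U contains only directions of the closure. A second normal is
  therefore orthogonal to all such t, hence parallel to the first, and outwardness fixes the
  sign.\<close>

lemma outer_normal_paraboloid:
  fixes x m :: "real^3"
  assumes "d > 0" "norm x = 1" "norm m = 1" "x \<bullet> m < 1"
    and U: "open U" "x \<in> U" "U \<inter> S2 \<subseteq> S2_closure \<Omega>"
      "\<And>z. z \<in> U \<Longrightarrow> z \<in> S2_closure \<Omega> \<Longrightarrow> \<rho> z = paraboloid_radius d m z"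
    and pos: "\<And>z. z \<in> S2_closure \<Omega> \<Longrightarrow> \<rho> z > 0"
  shows "outer_normal \<Omega> \<rho> x = (x - m) /\<^sub>R norm (x - m)"
proof -
  define p where "p = \<rho> x *\<^sub>R x"
  define \<sigma> where "\<sigma> = radial_graph \<Omega> \<rho>"
  define \<nu> where "\<nu> = (x - m) /\<^sub>R norm (x - m)"
  have xK: "x \<in> S2_closure \<Omega>"
    using U assms by auto
  have \<rho>x: "\<rho> x > 0" "\<rho> x * (1 - x \<bullet> m) = d"
    using pos[OF xK] U(4)[OF U(2) xK] assms by (auto simp: paraboloid_radius_def)
  have xx: "x \<bullet> x = 1"
    using assms by (auto simp: dot_square_norm)
  have xm: "norm (x - m) > 0"
    using assms(4) xx by auto
  have p: "norm p = \<rho> x" "p \<noteq> 0" "p /\<^sub>R norm p = x" "norm p - p \<bullet> m = d"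
    using \<rho>x assms by (auto simp: p_def algebra_simps)
  have \<nu>: "is_outer_unit_normal \<sigma> p \<nu>"
    unfolding \<sigma>_def p_def \<nu>_def using assms xK
    by (intro is_outer_unit_normal_paraboloid[where U = U and d = d]) auto
  have "\<nu>' = \<nu>" if \<nu>': "is_outer_unit_normal \<sigma> p \<nu>'" for \<nu>'
  proof -
    define c where "c = \<nu>' \<bullet> \<nu>"
    \<comment> \<open>The tangential part of the second normal. Testing \<nu>' along the curve with
      velocity t yields t . \<nu>' = 0, and then t . t = 0.\<close>
    define t where "t = \<nu>' - c *\<^sub>R \<nu>"
    have \<nu>\<nu>: "\<nu> \<bullet> \<nu> = 1"
      using \<nu> by (simp add: is_outer_unit_normal_def dot_square_norm)
    have t\<nu>: "t \<bullet> \<nu> = 0"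
      by (simp add: t_def inner_diff_left \<nu>\<nu> c_def)
    then have "t \<bullet> (x - m) = 0"
      using xm by (simp add: \<nu>_def)
    define y where "y s = (d / (norm (p + s *\<^sub>R t) - (p + s *\<^sub>R t) \<bullet> m)) *\<^sub>R (p + s *\<^sub>R t)" for s
    have y0: "y 0 = p"
      using p assms by (simp add: y_def)
    have "(y has_vector_derivative t) (at 0)"
      unfolding y_def using p assms \<open>t \<bullet> (x - m) = 0\<close> by (intro paraboloid_tangent_curve) auto
    then have "(y has_vector_derivative t) (at_right 0)"
      by (rule has_vector_derivative_at_within)
    then have quot: "((\<lambda>s. (y s - p) /\<^sub>R s) \<longlongrightarrow> t) (at_right 0)"
    proof -
      have "((\<lambda>s. (1 / norm s) *\<^sub>R (y s - (p + s *\<^sub>R t))) \<longlongrightarrow> 0) (at_right 0)"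
        using \<open>(y has_vector_derivative t) (at_right 0)\<close> y0
        by (simp add: has_vector_derivative_def has_derivative_within)
      moreover have "\<forall>\<^sub>F s in at_right 0. (1 / norm s) *\<^sub>R (y s - (p + s *\<^sub>R t)) = (y s - p) /\<^sub>R s - t"
        using eventually_at_right_less[of 0]
        by eventually_elim (simp add: algebra_simps divide_inverse)
      ultimately have "((\<lambda>s. (y s - p) /\<^sub>R s - t) \<longlongrightarrow> 0) (at_right 0)"
        by (rule Lim_transform_eventually)
      then show ?thesis
        by (rule LIM_zero_cancel)
    qed
    have "t = 0"
    proof (rule ccontr)
      assume "t \<noteq> 0"
      have "(y \<longlongrightarrow> p) (at_right 0)"
        using \<open>(y has_vector_derivative t) (at_right 0)\<close> y0
        by (metis has_vector_derivative_continuous continuous_within)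
      \<comment> \<open>The normal condition is a limit at p that excludes p itself; the difference
        quotient tends to t \<noteq> 0, so the curve leaves p at once.\<close>
      moreover have "\<forall>\<^sub>F s in at_right 0. y s \<noteq> p"
        using tendsto_imp_eventually_ne[OF quot \<open>t \<noteq> 0\<close>] by eventually_elim auto
      moreover have "\<forall>\<^sub>F s in at_right 0. y s \<in> \<sigma>"
      proof -
        have "((\<lambda>s. p + s *\<^sub>R t) \<longlongrightarrow> p + 0 *\<^sub>R t) (at_right 0)"
          by (intro tendsto_intros)
        then have lim: "((\<lambda>s. p + s *\<^sub>R t) \<longlongrightarrow> p) (at_right 0)"
          by simp
        then have "((\<lambda>s. (p + s *\<^sub>R t) /\<^sub>R norm (p + s *\<^sub>R t)) \<longlongrightarrow> p /\<^sub>R norm p) (at_right 0)"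
          using p by (intro tendsto_intros) auto
        then have "\<forall>\<^sub>F s in at_right 0. (p + s *\<^sub>R t) /\<^sub>R norm (p + s *\<^sub>R t) \<in> U"
          using U(1,2) p(3) by (auto dest: topological_tendstoD)
        moreover have "\<forall>\<^sub>F s in at_right 0. p + s *\<^sub>R t \<noteq> 0"
          using tendsto_imp_eventually_ne[OF lim] p by auto
        ultimately show ?thesis
        proof eventually_elim
          case (elim s)
          define q where "q = p + s *\<^sub>R t"
          define z where "z = q /\<^sub>R norm q"
          have q: "norm q > 0"
            using elim by (simp add: q_def)
          have z: "z \<in> U" "z \<in> S2_closure \<Omega>"
            using elim U by (auto simp: z_def q_def)
          have "1 - z \<bullet> m = (norm q - q \<bullet> m) / norm q"
            using q by (simp add: z_def field_simps)
          then have "y s = \<rho> z *\<^sub>R z"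
            using q by (simp add: U(4)[OF z] paraboloid_radius_def y_def flip: q_def) (simp add: z_def)
          then show ?case
            using z by (auto simp: \<sigma>_def radial_graph_def)
        qed
      qed
      ultimately have lim: "filterlim y (at p within \<sigma>) (at_right 0)"
        by (auto simp: filterlim_at eventually_conj_iff)
      then have "((\<lambda>s. ((y s - p) \<bullet> \<nu>') / norm (y s - p)) \<longlongrightarrow> 0) (at_right 0)"
        using \<nu>' unfolding is_outer_unit_normal_def by (auto intro: filterlim_compose[OF _ lim])
      moreover have "((\<lambda>s. ((y s - p) \<bullet> \<nu>') / norm (y s - p)) \<longlongrightarrow> (t \<bullet> \<nu>') / norm t) (at_right 0)"
      proof (rule Lim_transform_eventually)
        show "((\<lambda>s. (((y s - p) /\<^sub>R s) \<bullet> \<nu>') / norm ((y s - p) /\<^sub>R s)) \<longlongrightarrow> (t \<bullet> \<nu>') / norm t) (at_right 0)"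
          using \<open>t \<noteq> 0\<close> by (intro tendsto_intros quot) auto
        show "\<forall>\<^sub>F s in at_right 0. (((y s - p) /\<^sub>R s) \<bullet> \<nu>') / norm ((y s - p) /\<^sub>R s)
          = ((y s - p) \<bullet> \<nu>') / norm (y s - p)"
          using eventually_at_right_less[of 0] by eventually_elim (simp add: divide_simps)
      qed
      ultimately have "0 = (t \<bullet> \<nu>') / norm t"
        by (rule tendsto_unique[OF trivial_limit_at_right_real])
      then have "t \<bullet> \<nu>' = 0"
        using \<open>t \<noteq> 0\<close> by simp
      then have "t \<bullet> t = 0"
        using t\<nu> by (simp add: t_def inner_diff_right inner_diff_left)
      with \<open>t \<noteq> 0\<close> show False by simp
    qed
    then have \<nu>'_eq: "\<nu>' = c *\<^sub>R \<nu>"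
      by (simp add: t_def)
    then have "\<bar>c\<bar> = 1" "c * (p \<bullet> \<nu>) > 0" "p \<bullet> \<nu> > 0"
      using \<nu> \<nu>' by (auto simp: is_outer_unit_normal_def)
    then have "c = 1"
      by (smt (verit) zero_less_mult_iff)
    with \<nu>'_eq show ?thesis by simp
  qed
  with \<nu> have "(THE \<nu>. is_outer_unit_normal \<sigma> p \<nu>) = \<nu>"
    by (rule the_equality)
  then show ?thesis
    unfolding outer_normal_def \<sigma>_def p_def \<nu>_def .
qed

section \<open>Reflectors\<close>

lemma eventually_less_limits:
  fixes h k :: "'a \<Rightarrow> real"
  assumes "(h \<longlongrightarrow> a) F" "(k \<longlongrightarrow> b) F" "a < b"
  shows "\<forall>\<^sub>F x in F. h x < k x"
  using order_tendstoD(1)[OF tendsto_diff[OF assms(2,1)], of 0] assms(3) by simp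

locale reflector =
  fixes \<Omega> :: "(real^3) set" and f :: "real^3 \<Rightarrow> real" and N :: nat and m :: "nat \<Rightarrow> real^3" and \<delta> :: real
  assumes delta_pos: "0 < \<delta>"
    and boundary_null: "S2_boundary \<Omega> \<in> null_sets surface_measure"
    and f_integrable: "set_integrable surface_measure (S2_closure \<Omega>) f"
    and f_pos: "AE x in surface_measure. x \<in> S2_closure \<Omega> \<longrightarrow> f x > 0"
    and N_pos: "N > 0"
    and m_unit: "\<And>i. i \<in> {1..N} \<Longrightarrow> norm (m i) = 1"
    and m_inj: "inj_on m {1..N}"
    and m_separated: "\<And>x i. x \<in> S2_closure \<Omega> \<Longrightarrow> i \<in> {1..N} \<Longrightarrow> x \<bullet> m i \<le> 1 - \<delta>"
begin

text \<open>Cross-multiplied form of \<open>\<rho>\<^sub>w(x) = w\<^sub>i / (1 - x \<bullet> m\<^sub>i)\<close>.\<close>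
definition cell :: "(nat \<Rightarrow> real) \<Rightarrow> nat \<Rightarrow> (real^3) set" where
  "cell w i = {x \<in> S2_closure \<Omega>. \<forall>j\<in>{1..N}. w i * (1 - x \<bullet> m j) \<le> w j * (1 - x \<bullet> m i)}"

text \<open>The density (x . \<nu>) / \<rho>^2 of the paraboloid with parameter 1: with t = 1 - x .
  m_i, the factor t^2 is 1 / \<rho>^2 and sqrt (t / 2) is x . \<nu>.\<close>

definition kern :: "nat \<Rightarrow> real^3 \<Rightarrow> real" where
  "kern i x = (1 - x \<bullet> m i)\<^sup>2 * sqrt ((1 - x \<bullet> m i) / 2)"

text \<open>An explicit substitute for the reflector measure of m_i, integrating over
  \<open>cell w i\<close> instead of \<open>tau\<close>. The two sets can differ when the cell is
  empty, since a paraboloid with axis m_i and a smaller parameter may still touch the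
  reflector.\<close>

definition mass :: "(nat \<Rightarrow> real) \<Rightarrow> nat \<Rightarrow> real" where
  "mass w i = (LINT x:cell w i|surface_measure. f x * kern i x) / (w i)\<^sup>2"

lemma norm_closure: "x \<in> S2_closure \<Omega> \<Longrightarrow> norm x = 1"
  using closure_of_subset_topspace[of "top_of_set S2" \<Omega>] by auto

lemma closed_S2_closure: "closed (S2_closure \<Omega>)"
  by (rule closedin_closed_trans[OF closedin_closure_of]) simp

lemma one_minus_inner_ge: "x \<in> S2_closure \<Omega> \<Longrightarrow> i \<in> {1..N} \<Longrightarrow> \<delta> \<le> 1 - x \<bullet> m i"
  using m_separated[of x i] by simp

lemma one_minus_inner_pos: "x \<in> S2_closure \<Omega> \<Longrightarrow> i \<in> {1..N} \<Longrightarrow> 0 < 1 - x \<bullet> m i"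
  using m_separated[of x i] delta_pos by simp

lemma one_minus_inner_le: "x \<in> S2_closure \<Omega> \<Longrightarrow> i \<in> {1..N} \<Longrightarrow> 1 - x \<bullet> m i \<le> 2"
  using Cauchy_Schwarz_ineq2[of x "m i"] norm_closure[of x] m_unit[of i] by simp

lemma kern_nonneg: "x \<in> S2_closure \<Omega> \<Longrightarrow> i \<in> {1..N} \<Longrightarrow> 0 \<le> kern i x"
  using one_minus_inner_pos[of x i] by (simp add: kern_def)

lemma kern_le_4:
  assumes "x \<in> S2_closure \<Omega>" "i \<in> {1..N}"
  shows "kern i x \<le> 4"
proof -
  have t: "0 < 1 - x \<bullet> m i" "1 - x \<bullet> m i \<le> 2"
    using one_minus_inner_pos[OF assms] one_minus_inner_le[OF assms] by auto
  have "kern i x \<le> 2\<^sup>2 * 1"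
    unfolding kern_def using t by (intro mult_mono power_mono) auto
  then show ?thesis by simp
qed

lemma kern_measurable: "kern i \<in> borel_measurable surface_measure"
  unfolding kern_def by (intro continuous_on_S2_measurable continuous_intros) simp

section \<open>Cells: measurability, covering, and nullity of ties\<close>

lemma closed_cell: "closed (cell w i)"
proof -
  have "cell w i = S2_closure \<Omega> \<inter>
      (\<Inter>j\<in>{1..N}. {x. w i * (1 - x \<bullet> m j) \<le> w j * (1 - x \<bullet> m i)})"
    by (auto simp: cell_def)
  also have "closed \<dots>"
    by (intro closed_Int closed_INT closed_S2_closure ballI closed_Collect_le continuous_intros)
  finally show ?thesis .
qed

lemma cell_subset: "cell w i \<subseteq> S2_closure \<Omega>"
  by (auto simp: cell_def)

lemma cell_sets: "cell w i \<in> sets surface_measure"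
  using norm_closure by (intro closed_in_S2_sets closed_cell) (auto simp: cell_def)

lemma cell_cover:
  assumes "x \<in> S2_closure \<Omega>"
  obtains i where "i \<in> {1..N}" "x \<in> cell w i"
proof -
  define i where "i = arg_min_on (\<lambda>i. w i / (1 - x \<bullet> m i)) {1..N}"
  have ne: "finite {1..N}" "{1..N} \<noteq> {}"
    using N_pos by auto
  have i: "i \<in> {1..N}"
    unfolding i_def using ne by (rule arg_min_if_finite)
  have "w i * (1 - x \<bullet> m j) \<le> w j * (1 - x \<bullet> m i)" if "j \<in> {1..N}" for j
  proof -
    have "w i / (1 - x \<bullet> m i) \<le> w j / (1 - x \<bullet> m j)"
      unfolding i_def by (rule arg_min_least) (use ne that in auto)
    then show ?thesis
      using one_minus_inner_pos[OF assms i] one_minus_inner_pos[OF assms that] by (simp add: field_simps)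
  qed
  then show ?thesis
    using i assms by (intro that) (auto simp: cell_def)
qed

text \<open>A tie is the linear equation (w_j m_i - w_i m_j) . x = w_j - w_i, which describes a
  circle on the sphere. It does not degenerate: if w_i = w_j, the vector is a nonzero multiple of
  m_i - m_j.\<close>

lemma AE_not_tie:
  assumes "w i > 0" "w j > 0" "i \<in> {1..N}" "j \<in> {1..N}" "i \<noteq> j"
  shows "AE x in surface_measure. w i * (1 - x \<bullet> m j) \<noteq> w j * (1 - x \<bullet> m i)"
proof -
  let ?v = "w j *\<^sub>R m i - w i *\<^sub>R m j"
  have "?v \<noteq> 0 \<or> w j - w i \<noteq> 0"
    using assms inj_onD[OF m_inj] by auto
  then have "{x \<in> S2. ?v \<bullet> x = w j - w i} \<in> null_sets surface_measure"
    by (rule surface_null_circle)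
  then have "AE x in surface_measure. x \<notin> {x \<in> S2. ?v \<bullet> x = w j - w i}"
    by (rule AE_not_in)
  then show ?thesis
    using AE_space
  proof eventually_elim
    case (elim x)
    then have "w j * (m i \<bullet> x) - w i * (m j \<bullet> x) \<noteq> w j - w i"
      by (simp add: space_surface_measure inner_diff_left)
    then show ?case
      by (simp add: inner_commute[of x] algebra_simps)
  qed
qed

lemma AE_no_ties:
  assumes "\<And>j. j \<in> {1..N} \<Longrightarrow> w j > 0" "i \<in> {1..N}"
  shows "AE x in surface_measure. \<forall>j\<in>{1..N} - {i}. w i * (1 - x \<bullet> m j) \<noteq> w j * (1 - x \<bullet> m i)"
  using assms by (intro AE_finite_allI AE_not_tie) auto

section \<open>Masses of cells: integrability, continuity, monotonicity and total mass\<close>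

lemma integrable_f_kern:
  assumes "i \<in> {1..N}"
  shows "set_integrable surface_measure (S2_closure \<Omega>) (\<lambda>x. f x * kern i x)"
proof -
  have "integrable surface_measure (\<lambda>x. 4 * (indicator (S2_closure \<Omega>) x *\<^sub>R f x))"
    using f_integrable by (simp add: set_integrable_def)
  then show ?thesis
    unfolding set_integrable_def
  proof (rule Bochner_Integration.integrable_bound)
    have "(\<lambda>x. (indicator (S2_closure \<Omega>) x *\<^sub>R f x) * kern i x) \<in> borel_measurable surface_measure"
      using borel_measurable_integrable[OF f_integrable[unfolded set_integrable_def]] kern_measurable
      by (rule borel_measurable_times)
    then show "(\<lambda>x. indicator (S2_closure \<Omega>) x *\<^sub>R (f x * kern i x)) \<in> borel_measurable surface_measure"
      by (simp add: mult.assoc)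
    show "AE x in surface_measure. norm (indicator (S2_closure \<Omega>) x *\<^sub>R (f x * kern i x))
            \<le> norm (4 * (indicator (S2_closure \<Omega>) x *\<^sub>R f x))"
      using kern_le_4[OF _ assms] kern_nonneg[OF _ assms]
      by (intro AE_I2) (auto simp: indicator_def abs_mult mult.commute intro!: mult_left_mono)
  qed
qed

lemma cell_integrable:
  "i \<in> {1..N} \<Longrightarrow> set_integrable surface_measure (cell w j) (\<lambda>x. f x * kern i x)"
  using integrable_f_kern cell_sets cell_subset by (rule set_integrable_subset)

text \<open>Dominated convergence with majorant |f k_i| on the closure. Off the ties, membership of
  x in the cell is decided by strict inequalities, so it is the same for \<open>W n\<close> and
  \<open>w\<close> from some n on.\<close>

lemma mass_tendsto:
  assumes lim: "\<And>j. j \<in> {1..N} \<Longrightarrow> (\<lambda>n. W n j) \<longlonglongrightarrow> w j"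
    and pos: "\<And>j. j \<in> {1..N} \<Longrightarrow> w j > 0" and i: "i \<in> {1..N}"
  shows "(\<lambda>n. mass (W n) i) \<longlonglongrightarrow> mass w i"
proof -
  have "(\<lambda>n. LINT x:cell (W n) i|surface_measure. f x * kern i x)
          \<longlonglongrightarrow> (LINT x:cell w i|surface_measure. f x * kern i x)"
    unfolding set_lebesgue_integral_def
  proof (rule integral_dominated_convergence)
    have meas: "(\<lambda>x. indicator (cell v i) x *\<^sub>R (f x * kern i x)) \<in> borel_measurable surface_measure" for v
      using cell_integrable[OF i] unfolding set_integrable_def by (rule borel_measurable_integrable)
    show "(\<lambda>x. indicator (cell w i) x *\<^sub>R (f x * kern i x)) \<in> borel_measurable surface_measure"
      by (rule meas)
    show "(\<lambda>x. indicator (cell (W n) i) x *\<^sub>R (f x * kern i x)) \<in> borel_measurable surface_measure" for n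
      by (rule meas)
    show "integrable surface_measure (\<lambda>x. norm (indicator (S2_closure \<Omega>) x *\<^sub>R (f x * kern i x)))"
      using integrable_f_kern[OF i] unfolding set_integrable_def by (rule integrable_norm)
    show "AE x in surface_measure. norm (indicator (cell (W n) i) x *\<^sub>R (f x * kern i x))
            \<le> norm (indicator (S2_closure \<Omega>) x *\<^sub>R (f x * kern i x))" for n
      using cell_subset by (intro AE_I2) (auto simp: indicator_def)
    have "AE x in surface_measure. \<forall>j\<in>{1..N} - {i}. w i * (1 - x \<bullet> m j) \<noteq> w j * (1 - x \<bullet> m i)"
      using pos i by (rule AE_no_ties)
    then show "AE x in surface_measure. (\<lambda>n. indicator (cell (W n) i) x *\<^sub>R (f x * kern i x))
            \<longlonglongrightarrow> indicator (cell w i) x *\<^sub>R (f x * kern i x)"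
    proof eventually_elim
      case (elim x)
      have lims: "(\<lambda>n. W n i * (1 - x \<bullet> m j)) \<longlonglongrightarrow> w i * (1 - x \<bullet> m j)"
        "(\<lambda>n. W n j * (1 - x \<bullet> m i)) \<longlonglongrightarrow> w j * (1 - x \<bullet> m i)" if "j \<in> {1..N}" for j
        using lim[OF i] lim[OF that] by (auto intro: tendsto_mult_right)
      have "\<forall>\<^sub>F n in sequentially. x \<in> cell (W n) i \<longleftrightarrow> x \<in> cell w i"
      proof (cases "x \<in> cell w i")
        case True
        have "\<forall>j\<in>{1..N}. \<forall>\<^sub>F n in sequentially. W n i * (1 - x \<bullet> m j) \<le> W n j * (1 - x \<bullet> m i)"
        proof
          fix j assume j: "j \<in> {1..N}"
          show "\<forall>\<^sub>F n in sequentially. W n i * (1 - x \<bullet> m j) \<le> W n j * (1 - x \<bullet> m i)"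
          \<comment> \<open>The comparison of i with itself is an equality for every n and is
            treated apart from the strict ones.\<close>
          proof (cases "j = i")
            case False
            then have "w i * (1 - x \<bullet> m j) < w j * (1 - x \<bullet> m i)"
              using True elim j by (auto simp: cell_def less_le)
            then have "\<forall>\<^sub>F n in sequentially. W n i * (1 - x \<bullet> m j) < W n j * (1 - x \<bullet> m i)"
              using lims[OF j] by (intro eventually_less_limits)
            then show ?thesis by (rule eventually_mono) simp
          qed simp
        qed
        then have "\<forall>\<^sub>F n in sequentially. \<forall>j\<in>{1..N}. W n i * (1 - x \<bullet> m j) \<le> W n j * (1 - x \<bullet> m i)"
          by (intro eventually_ball_finite) auto
        then show ?thesis
          by (rule eventually_mono) (use True in \<open>auto simp: cell_def\<close>)
      next
        case False
        show ?thesis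
        proof (cases "x \<in> S2_closure \<Omega>")
          case True
          with False obtain j where j: "j \<in> {1..N}" "w j * (1 - x \<bullet> m i) < w i * (1 - x \<bullet> m j)"
            by (auto simp: cell_def not_le)
          then have "\<forall>\<^sub>F n in sequentially. W n j * (1 - x \<bullet> m i) < W n i * (1 - x \<bullet> m j)"
            using lims[OF j(1)] j(2) by (intro eventually_less_limits)
          then have "\<forall>\<^sub>F n in sequentially. x \<notin> cell (W n) i"
            by (rule eventually_mono) (use j(1) in \<open>force simp: cell_def\<close>)
          then show ?thesis
            by (rule eventually_mono) (use False in simp)
        qed (use cell_subset in \<open>auto intro!: always_eventually\<close>)
      qed
      then show ?case
        by (intro tendsto_eventually) (auto elim!: eventually_mono simp: indicator_def)
    qed
  qed
  then show ?thesis
    unfolding mass_def using lim[OF i] pos[OF i] by (intro tendsto_intros) auto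
qed

text \<open>With w_i fixed, lowering the other parameters only tightens the inequalities that define
  the i-th cell, while the nonnegative density on it is unchanged.\<close>

lemma mass_mono:
  assumes "i \<in> {1..N}" "w' i = w i" and le: "\<And>j. j \<in> {1..N} \<Longrightarrow> w' j \<le> w j"
  shows "mass w' i \<le> mass w i"
proof -
  have sub: "cell w' i \<subseteq> cell w i"
  proof
    fix x assume x: "x \<in> cell w' i"
    have "w i * (1 - x \<bullet> m j) \<le> w j * (1 - x \<bullet> m i)" if j: "j \<in> {1..N}" for j
    proof -
      have "w i * (1 - x \<bullet> m j) \<le> w' j * (1 - x \<bullet> m i)"
        using x j assms(2) by (force simp: cell_def)
      also have "\<dots> \<le> w j * (1 - x \<bullet> m i)"
        using le[OF j] one_minus_inner_pos[of x i] x assms(1) cell_subset[of w' i] by (intro mult_right_mono) auto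
      finally show ?thesis .
    qed
    then show "x \<in> cell w i"
      using x by (auto simp: cell_def)
  qed
  have "(LINT x:cell w' i|surface_measure. f x * kern i x) \<le> (LINT x:cell w i|surface_measure. f x * kern i x)"
    unfolding set_lebesgue_integral_def
  proof (rule integral_mono_AE)
    show "AE x in surface_measure. indicator (cell w' i) x *\<^sub>R (f x * kern i x)
            \<le> indicator (cell w i) x *\<^sub>R (f x * kern i x)"
      using f_pos
    proof eventually_elim
      case (elim x)
      then show ?case
        using sub cell_subset[of w i] kern_nonneg[of x i] assms(1) by (auto simp: indicator_def)
    qed
  qed (use cell_integrable[OF assms(1)] in \<open>auto simp: set_integrable_def\<close>)
  then show ?thesis
    unfolding mass_def assms(2) by (intro divide_right_mono) auto
qed

text \<open>The reflector lies inside the first paraboloid, so \<rho> \<le> w_1 / \<delta>, and x .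
  \<nu> = sqrt ((1 - x . m_i) / 2) \<ge> sqrt (\<delta> / 2) on the i-th cell. Together these bound
  the density from below by the stated constant times f, and the cells cover the closure.\<close>

lemma sum_mass_ge:
  assumes pos: "\<And>j. j \<in> {1..N} \<Longrightarrow> w j > 0"
  shows "(\<Sum>i=1..N. mass w i) \<ge> sqrt (\<delta> / 2) * \<delta>\<^sup>2 / (w 1)\<^sup>2 * (LINT x:S2_closure \<Omega>|surface_measure. f x)"
proof -
  have one: "1 \<in> {1..N}" using N_pos by auto
  define c where "c = sqrt (\<delta> / 2) * \<delta>\<^sup>2 / (w 1)\<^sup>2"
  have c: "c \<le> kern i x / (w i)\<^sup>2" if "i \<in> {1..N}" "x \<in> cell w i" for i x
  proof -
    have x: "x \<in> S2_closure \<Omega>" using that cell_subset by auto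
    have d: "\<delta> \<le> 1 - x \<bullet> m 1" "\<delta> \<le> 1 - x \<bullet> m i"
      using one_minus_inner_ge[OF x] one that by auto
    have "w i * \<delta> \<le> w i * (1 - x \<bullet> m 1)"
      using d pos[OF that(1)] by (intro mult_left_mono) auto
    also have "\<dots> \<le> w 1 * (1 - x \<bullet> m i)"
      using that one by (auto simp: cell_def)
    finally have "\<delta> / w 1 \<le> (1 - x \<bullet> m i) / w i"
      using pos[OF that(1)] pos[OF one] by (simp add: field_simps)
    then have "(\<delta> / w 1)\<^sup>2 \<le> ((1 - x \<bullet> m i) / w i)\<^sup>2"
      using delta_pos pos[OF one] by (intro power_mono) auto
    moreover have "sqrt (\<delta> / 2) \<le> sqrt ((1 - x \<bullet> m i) / 2)"
      using d by simp
    ultimately have "sqrt (\<delta> / 2) * (\<delta> / w 1)\<^sup>2 \<le> sqrt ((1 - x \<bullet> m i) / 2) * ((1 - x \<bullet> m i) / w i)\<^sup>2"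
      using d delta_pos by (intro mult_mono) auto
    then show ?thesis
      by (simp add: c_def kern_def power_divide mult.commute)
  qed
  have int: "integrable surface_measure (\<lambda>x. indicator (cell w i) x *\<^sub>R (f x * kern i x) / (w i)\<^sup>2)"
    if "i \<in> {1..N}" for i
    using cell_integrable[OF that] by (auto simp: set_integrable_def)
  have "c * (LINT x:S2_closure \<Omega>|surface_measure. f x)
      = (LINT x|surface_measure. c * (indicator (S2_closure \<Omega>) x *\<^sub>R f x))"
    by (simp add: set_lebesgue_integral_def)
  also have "\<dots> \<le> (LINT x|surface_measure. (\<Sum>i=1..N. indicator (cell w i) x *\<^sub>R (f x * kern i x) / (w i)\<^sup>2))"
  proof (rule integral_mono_AE)
    show "AE x in surface_measure. c * (indicator (S2_closure \<Omega>) x *\<^sub>R f x)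
            \<le> (\<Sum>i=1..N. indicator (cell w i) x *\<^sub>R (f x * kern i x) / (w i)\<^sup>2)"
      using f_pos
    proof eventually_elim
      case (elim x)
      have nonneg: "0 \<le> indicator (cell w i) x *\<^sub>R (f x * kern i x) / (w i)\<^sup>2" if "i \<in> {1..N}" for i
        using elim cell_subset[of w i] kern_nonneg[of x i] that by (auto simp: indicator_def)
      show ?case
      proof (cases "x \<in> S2_closure \<Omega>")
        case True
        \<comment> \<open>Cells may overlap on ties, so the sum is bounded below by the term of just
          one cell containing x.\<close>
        obtain i where i: "i \<in> {1..N}" "x \<in> cell w i"
          using cell_cover[OF True] .
        have "c * f x \<le> (kern i x / (w i)\<^sup>2) * f x"
          using c[OF i] elim True by (intro mult_right_mono) auto
        also have "\<dots> = indicator (cell w i) x *\<^sub>R (f x * kern i x) / (w i)\<^sup>2"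
          using i by simp
        also have "\<dots> \<le> (\<Sum>i=1..N. indicator (cell w i) x *\<^sub>R (f x * kern i x) / (w i)\<^sup>2)"
          using i nonneg by (intro member_le_sum) auto
        finally show ?thesis using True by simp
      next
        case False
        then show ?thesis using nonneg by (auto intro: sum_nonneg)
      qed
    qed
  qed (use f_integrable int in \<open>auto simp: set_integrable_def\<close>)
  also have "\<dots> = (\<Sum>i=1..N. mass w i)"
    using int by (subst Bochner_Integration.integral_sum) (auto simp: mass_def set_lebesgue_integral_def)
  finally show ?thesis by (simp add: c_def)
qed

lemma cell_nonempty: "mass w i \<noteq> 0 \<Longrightarrow> cell w i \<noteq> {}"
  by (auto simp: mass_def set_lebesgue_integral_def)

section \<open>From cells to contact sets and the reflector measure\<close>

lemma reflector_radius_le: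
  "i \<in> {1..N} \<Longrightarrow> reflector_radius N m w x \<le> paraboloid_radius (w i) (m i) x"
  unfolding reflector_radius_def by (intro Min_le) auto

lemma reflector_radius_eq_iff:
  assumes "x \<in> S2_closure \<Omega>" "i \<in> {1..N}"
  shows "reflector_radius N m w x = paraboloid_radius (w i) (m i) x \<longleftrightarrow> x \<in> cell w i"
proof -
  have "reflector_radius N m w x = paraboloid_radius (w i) (m i) x \<longleftrightarrow>
      (\<forall>j\<in>{1..N}. paraboloid_radius (w i) (m i) x \<le> paraboloid_radius (w j) (m j) x)"
    unfolding reflector_radius_def using assms N_pos by (subst Min_eq_iff) auto
  also have "\<dots> \<longleftrightarrow> x \<in> cell w i"
    unfolding cell_def paraboloid_radius_def
    using assms one_minus_inner_pos[OF assms(1)] by (auto simp: field_simps)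
  finally show ?thesis .
qed

lemma reflector_radius_pos:
  assumes "x \<in> S2_closure \<Omega>" "\<And>j. j \<in> {1..N} \<Longrightarrow> w j > 0"
  shows "reflector_radius N m w x > 0"
  unfolding reflector_radius_def paraboloid_radius_def
  using assms N_pos one_minus_inner_pos[OF assms(1)] by (subst Min_gr_iff) auto

lemma cell_subset_tau:
  assumes "i \<in> {1..N}" "w i > 0"
  shows "cell w i \<subseteq> tau \<Omega> (reflector_radius N m w) (m i)"
  using assms cell_subset[of w i] reflector_radius_le reflector_radius_eq_iff
  by (fastforce simp: tau_def paraboloid_supports_def)

lemma closure_eq_Union_tau:
  assumes "\<And>j. j \<in> {1..N} \<Longrightarrow> w j > 0"
  shows "S2_closure \<Omega> = (\<Union>i\<in>{1..N}. tau \<Omega> (reflector_radius N m w) (m i))"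
proof
  show "S2_closure \<Omega> \<subseteq> (\<Union>i\<in>{1..N}. tau \<Omega> (reflector_radius N m w) (m i))"
  proof
    fix x assume "x \<in> S2_closure \<Omega>"
    then obtain i where "i \<in> {1..N}" "x \<in> cell w i"
      by (rule cell_cover)
    then show "x \<in> (\<Union>i\<in>{1..N}. tau \<Omega> (reflector_radius N m w) (m i))"
      using cell_subset_tau[of i w] assms by blast
  qed
qed (auto simp: tau_def)

text \<open>
  At most one paraboloid with a given axis supports the reflector, and a point of the cell shows
  that its parameter is \<open>w i\<close>.
\<close>
lemma tau_eq_cell:
  assumes i: "i \<in> {1..N}" "w i > 0" and "cell w i \<noteq> {}"
  shows "tau \<Omega> (reflector_radius N m w) (m i) = cell w i"
proof
  show "cell w i \<subseteq> tau \<Omega> (reflector_radius N m w) (m i)"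
    using i by (rule cell_subset_tau)
  show "tau \<Omega> (reflector_radius N m w) (m i) \<subseteq> cell w i"
  proof
    fix x assume "x \<in> tau \<Omega> (reflector_radius N m w) (m i)"
    then obtain d where x: "x \<in> S2_closure \<Omega>"
      and d: "paraboloid_supports \<Omega> (reflector_radius N m w) d (m i) x"
      by (auto simp: tau_def)
    obtain z where z: "z \<in> cell w i" "z \<in> S2_closure \<Omega>"
      using assms(3) cell_subset by blast
    have "reflector_radius N m w z = paraboloid_radius (w i) (m i) z"
      using z reflector_radius_eq_iff[OF z(2) i(1)] by simp
    then have "paraboloid_radius (w i) (m i) z \<le> paraboloid_radius d (m i) z"
      using z d by (force simp: paraboloid_supports_def)
    then have "w i \<le> d"
      using one_minus_inner_pos[OF z(2) i(1)] by (simp add: paraboloid_radius_def divide_le_cancel)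
    moreover have "paraboloid_radius d (m i) x \<le> paraboloid_radius (w i) (m i) x"
      using reflector_radius_le[OF i(1), of w x] d by (simp add: paraboloid_supports_def)
    then have "d \<le> w i"
      using one_minus_inner_pos[OF x i(1)] by (simp add: paraboloid_radius_def divide_le_cancel)
    ultimately show "x \<in> cell w i"
      using d reflector_radius_eq_iff[OF x i(1)] by (auto simp: paraboloid_supports_def)
  qed
qed

text \<open>Off the ties the inequalities at x are strict and persist on an open set V; off the
  boundary x lies in the relative interior, cut out by an open T. Over T \<inter> V the reflector is
  the i-th paraboloid alone.\<close>

lemma outer_normal_cell:
  assumes pos: "\<And>j. j \<in> {1..N} \<Longrightarrow> w j > 0" and i: "i \<in> {1..N}" and x: "x \<in> cell w i"
    and int: "x \<notin> S2_boundary \<Omega>"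
    and strict: "\<forall>j\<in>{1..N} - {i}. w i * (1 - x \<bullet> m j) \<noteq> w j * (1 - x \<bullet> m i)"
  shows "outer_normal \<Omega> (reflector_radius N m w) x = (x - m i) /\<^sub>R norm (x - m i)"
proof -
  have xK: "x \<in> S2_closure \<Omega>" using x cell_subset by auto
  have "x \<in> (top_of_set S2) interior_of \<Omega>"
    using xK int by (auto simp: frontier_of_def)
  moreover have "openin (top_of_set S2) ((top_of_set S2) interior_of \<Omega>)"
    by (rule openin_interior_of)
  then obtain T where T: "open T" "(top_of_set S2) interior_of \<Omega> = S2 \<inter> T"
    unfolding openin_open by blast
  define V where "V = (\<Inter>j\<in>{1..N} - {i}. {z. w i * (1 - z \<bullet> m j) < w j * (1 - z \<bullet> m i)})"
  show ?thesis
  proof (rule outer_normal_paraboloid)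
    show "open (T \<inter> V)"
      unfolding V_def
      by (intro open_Int open_INT T ballI open_Collect_less continuous_intros finite_Diff finite_atLeastAtMost)
    show "x \<in> T \<inter> V"
      using \<open>x \<in> (top_of_set S2) interior_of \<Omega>\<close> T x strict by (auto simp: V_def cell_def less_le)
    have "(top_of_set S2) interior_of \<Omega> \<subseteq> S2_closure \<Omega>"
      by (rule interior_of_subset_closure_of)
    then show "(T \<inter> V) \<inter> S2 \<subseteq> S2_closure \<Omega>"
      using T by auto
    fix z assume z: "z \<in> T \<inter> V" "z \<in> S2_closure \<Omega>"
    have "w i * (1 - z \<bullet> m j) \<le> w j * (1 - z \<bullet> m i)" if "j \<in> {1..N}" for j
      using z that by (cases "j = i") (auto simp: V_def intro: less_imp_le)
    then have "z \<in> cell w i"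
      using z by (simp add: cell_def)
    then show "reflector_radius N m w z = paraboloid_radius (w i) (m i) z"
      using z i reflector_radius_eq_iff by blast
  next
    show "norm x = 1" "norm (m i) = 1" "x \<bullet> m i < 1" "w i > 0"
      using norm_closure[OF xK] m_unit[OF i] one_minus_inner_pos[OF xK i] pos[OF i] by auto
    show "reflector_radius N m w z > 0" if "z \<in> S2_closure \<Omega>" for z
      using that pos by (rule reflector_radius_pos)
  qed
qed

lemma reflector_density:
  assumes "x \<in> cell w i" "i \<in> {1..N}" "w i > 0"
    and \<nu>: "outer_normal \<Omega> (reflector_radius N m w) x = (x - m i) /\<^sub>R norm (x - m i)"
  shows "(x \<bullet> outer_normal \<Omega> (reflector_radius N m w) x) / (reflector_radius N m w x)\<^sup>2 = kern i x / (w i)\<^sup>2"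
proof -
  have x: "x \<in> S2_closure \<Omega>" using assms cell_subset by auto
  define t where "t = 1 - x \<bullet> m i"
  have t: "t > 0" using one_minus_inner_pos[OF x assms(2)] by (simp add: t_def)
  have xx: "x \<bullet> x = 1" "m i \<bullet> m i = 1"
    using norm_closure[OF x] m_unit[OF assms(2)] by (auto simp: dot_square_norm)
  have "norm (x - m i) = sqrt (2 * t)"
    by (simp add: norm_eq_sqrt_inner inner_diff_left inner_diff_right xx inner_commute[of "m i" x] t_def)
  then have "x \<bullet> outer_normal \<Omega> (reflector_radius N m w) x = t / sqrt (2 * t)"
    by (simp add: \<nu> inner_diff_right xx t_def divide_inverse mult.commute)
  also have "\<dots> = sqrt (t / 2)"
    using t by (intro real_sqrt_unique[symmetric]) (auto simp: power_divide power2_eq_square)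
  finally have "x \<bullet> outer_normal \<Omega> (reflector_radius N m w) x = sqrt (t / 2)" .
  moreover have "reflector_radius N m w x = w i / t"
    using reflector_radius_eq_iff[OF x assms(2)] assms(1) by (simp add: paraboloid_radius_def t_def)
  ultimately show ?thesis
    by (simp add: kern_def power_divide flip: t_def)
qed

text \<open>Nonemptiness of the cell identifies it with \<open>tau\<close>. Outside the boundary and
  the ties the normal is explicit, and the remaining points form a null set.\<close>

lemma reflector_measure_eq_mass:
  assumes pos: "\<And>j. j \<in> {1..N} \<Longrightarrow> w j > 0" and i: "i \<in> {1..N}" and "cell w i \<noteq> {}"
  shows "reflector_measure \<Omega> f (reflector_radius N m w) {m i} = mass w i"
proof -
  let ?\<rho> = "reflector_radius N m w"
  have "(\<Union>m\<in>{m i}. tau \<Omega> ?\<rho> m) = cell w i"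
    using tau_eq_cell[OF i pos[OF i] assms(3)] by simp
  then have "reflector_measure \<Omega> f ?\<rho> {m i} =
      (LINT x|surface_measure. indicator (cell w i) x *\<^sub>R (f x * ((x \<bullet> outer_normal \<Omega> ?\<rho> x) / (?\<rho> x)\<^sup>2)))"
    by (simp add: reflector_measure_def set_lebesgue_integral_def)
  also have "\<dots> = (LINT x|surface_measure. indicator (cell w i) x *\<^sub>R (f x * kern i x) / (w i)\<^sup>2)"
  proof (rule surface_integral_cong_AE)
    have "integrable surface_measure (\<lambda>x. indicator (cell w i) x *\<^sub>R (f x * kern i x) / (w i)\<^sup>2)"
      using cell_integrable[OF i] by (auto simp: set_integrable_def)
    then show "(\<lambda>x. indicator (cell w i) x *\<^sub>R (f x * kern i x) / (w i)\<^sup>2) \<in> borel_measurable surface_measure"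
      by (rule borel_measurable_integrable)
    have "AE x in surface_measure. \<forall>j\<in>{1..N} - {i}. w i * (1 - x \<bullet> m j) \<noteq> w j * (1 - x \<bullet> m i)"
      using pos i by (rule AE_no_ties)
    moreover have "AE x in surface_measure. x \<notin> S2_boundary \<Omega>"
      using boundary_null by (rule AE_not_in)
    ultimately show "AE x in surface_measure.
        indicator (cell w i) x *\<^sub>R (f x * ((x \<bullet> outer_normal \<Omega> ?\<rho> x) / (?\<rho> x)\<^sup>2)) =
        indicator (cell w i) x *\<^sub>R (f x * kern i x) / (w i)\<^sup>2"
    proof eventually_elim
      case (elim x)
      show ?case
      proof (cases "x \<in> cell w i")
        case True
        then show ?thesis
          using reflector_density[OF True i pos[OF i] outer_normal_cell[OF pos i True elim(2,1)]] by simp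
      qed simp
    qed
  qed
  also have "\<dots> = mass w i"
    by (simp add: mass_def set_lebesgue_integral_def)
  finally show ?thesis .
qed

section \<open>A priori bounds and existence by minimisation\<close>

lemma admissible_lower_bounds:
  assumes pos: "\<And>j. j \<in> {1..N} \<Longrightarrow> w j > 0"
    and g: "\<And>i. i \<in> {1..N} \<Longrightarrow> g i > 0"
    and le: "\<And>i. i \<in> {2..N} \<Longrightarrow> mass w i \<le> g i"
    and "\<delta> < 1"
    and energy: "1 / reflector_const (w 1) \<delta> * (\<Sum>i=1..N. g i) \<le> (LINT x:S2_closure \<Omega>|surface_measure. f x)"
  shows "mass w 1 > g 1" and "\<And>i. i \<in> {1..N} \<Longrightarrow> w i \<ge> w 1 * \<delta> / 2"
proof -
  let ?F = "LINT x:S2_closure \<Omega>|surface_measure. f x"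
  have one: "1 \<in> {1..N}" using N_pos by auto
  have w1: "w 1 > 0" using pos[OF one] .
  have C: "reflector_const (w 1) \<delta> > 0"
    using w1 delta_pos by (simp add: reflector_const_def)
  have G: "(\<Sum>i=1..N. g i) > 0"
    using one g by (intro sum_pos) auto
  then have F: "?F > 0"
    using C energy by (smt (verit) divide_pos_pos mult_pos_pos)
  have "(\<Sum>i=1..N. g i) \<le> reflector_const (w 1) \<delta> * ?F"
    using C energy by (simp add: field_simps)
  \<comment> \<open>The constant C differs from the one in \<open>sum_mass_ge\<close> only by
    \<delta> / 2 in place of sqrt (\<delta> / 2). As 0 < \<delta> / 2 < 1 the root is larger, and
    with F > 0 this gap makes the final inequality strict.\<close>
  also have "\<dots> = \<delta> / 2 * \<delta>\<^sup>2 / (w 1)\<^sup>2 * ?F"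
    by (simp add: reflector_const_def power2_eq_square power3_eq_cube)
  also have "\<dots> < sqrt (\<delta> / 2) * \<delta>\<^sup>2 / (w 1)\<^sup>2 * ?F"
  proof -
    have "(\<delta> / 2)\<^sup>2 < \<delta> / 2"
      using delta_pos \<open>\<delta> < 1\<close> by (simp add: power2_eq_square)
    then have "\<delta> / 2 < sqrt (\<delta> / 2)"
      by (rule real_less_rsqrt)
    then show ?thesis
      using F w1 delta_pos by (intro mult_strict_right_mono divide_strict_right_mono) auto
  qed
  also have "\<dots> \<le> (\<Sum>i=1..N. mass w i)"
    using pos by (rule sum_mass_ge)
  finally have "(\<Sum>i=1..N. g i) < (\<Sum>i=1..N. mass w i)" .
  moreover have "(\<Sum>i=1..N. h i) = h 1 + (\<Sum>i=2..N. h i)" for h :: "nat \<Rightarrow> real"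
    using one by (simp add: sum.atLeast_Suc_atMost numeral_2_eq_2)
  moreover have "(\<Sum>i=2..N. mass w i) \<le> (\<Sum>i=2..N. g i)"
    by (intro sum_mono le)
  ultimately show gt: "mass w 1 > g 1"
    by simp
  \<comment> \<open>At a contact point x of the first paraboloid, w_1 (1 - x . m_i) \<le> w_i (1 - x
    . m_1); the left factor is at least \<delta> and the right one at most 2.\<close>
  have "cell w 1 \<noteq> {}"
    using gt g[OF one] by (intro cell_nonempty) auto
  then obtain x where x: "x \<in> cell w 1" "x \<in> S2_closure \<Omega>"
    using cell_subset by blast
  fix i assume i: "i \<in> {1..N}"
  have "w 1 * \<delta> \<le> w 1 * (1 - x \<bullet> m i)"
    using one_minus_inner_ge[OF x(2) i] w1 by (intro mult_left_mono) auto
  also have "\<dots> \<le> w i * (1 - x \<bullet> m 1)"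
    using x(1) i by (auto simp: cell_def)
  also have "\<dots> \<le> w i * 2"
    using one_minus_inner_le[OF x(2) one] pos[OF i] by (intro mult_left_mono) auto
  finally show "w i \<ge> w 1 * \<delta> / 2" by simp
qed

text \<open>
  A tuple of minimal total size among those with at most the prescribed mass at \<open>m\<^sub>2, \<dots>, m\<^sub>N\<close> has no
  slack left: lowering \<open>w\<^sub>i\<close> slightly keeps the mass at \<open>m\<^sub>i\<close> below \<open>g\<^sub>i\<close> by continuity and does not
  increase the masses at the other \<open>m\<^sub>j\<close>, \<open>j \<ge> 2\<close>.
\<close>
lemma ex_prescribed_mass:
  assumes a': "a' > 0" and "\<delta> < 1"
    and g: "\<And>i. i \<in> {1..N} \<Longrightarrow> g i > 0"
    and energy: "1 / reflector_const a' \<delta> * (\<Sum>i=1..N. g i) \<le> (LINT x:S2_closure \<Omega>|surface_measure. f x)"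
  obtains w where "w 1 = a'" "\<And>i. i \<in> {1..N} \<Longrightarrow> w i \<ge> a' * \<delta> / 2"
    "\<And>i. i \<in> {2..N} \<Longrightarrow> mass w i = g i"
proof -
  \<comment> \<open>\<open>lo\<close> is the a priori bound of
    \<open>admissible_lower_bounds\<close>. \<open>hi\<close> exceeds 2 a' / \<delta>, so that a
    paraboloid with this parameter lies strictly outside the first one over the whole
    closure.\<close>
  define lo where "lo = a' * \<delta> / 2"
  define hi where "hi = 2 * a' / \<delta> + 1"
  have lo: "0 < lo" "lo \<le> a'" "lo \<le> hi"
  proof -
    show "0 < lo" using a' delta_pos by (simp add: lo_def)
    show "lo \<le> a'" using a' \<open>\<delta> < 1\<close> by (simp add: lo_def)
    moreover have "a' * \<delta> \<le> a' * 2"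
      using a' \<open>\<delta> < 1\<close> by (intro mult_left_mono) auto
    then have "a' \<le> hi"
      using delta_pos by (simp add: hi_def field_simps)
    ultimately show "lo \<le> hi" by simp
  qed
  \<comment> \<open>All coordinates outside 2..N, not just the first, are frozen at a', which makes
    the box compact in the product topology on all functions.\<close>
  define B where "B = PiE UNIV (\<lambda>i. if i \<in> {2..N} then {lo..hi} else {a'})"
  have B_iff: "w \<in> B \<longleftrightarrow> (\<forall>i\<in>{2..N}. lo \<le> w i \<and> w i \<le> hi) \<and> (\<forall>i. i \<notin> {2..N} \<longrightarrow> w i = a')" for w
    by (auto simp: B_def PiE_iff)
  have "compactin (product_topology (\<lambda>i. euclidean) UNIV) B"
    unfolding B_def by (subst compactin_PiE) auto
  then have "compact B"
    by (simp add: euclidean_product_topology)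
  have Bpos: "w j > 0" if "w \<in> B" for w j
    using that lo a' by (cases "j \<in> {2..N}") (force simp: B_iff)+
  have cont: "continuous_on B (\<lambda>w. mass w i)" if "i \<in> {1..N}" for i
    \<comment> \<open>The product topology over the naturals is first countable, so sequences
      suffice, and their convergence is coordinatewise.\<close>
    unfolding continuous_on_sequentially o_def
  proof (intro allI ballI impI, elim conjE)
    fix W :: "nat \<Rightarrow> nat \<Rightarrow> real" and w assume "w \<in> B" "W \<longlonglongrightarrow> w"
    have "(\<lambda>n. W n j) \<longlonglongrightarrow> w j" for j
    proof -
      have "isCont (\<lambda>w :: nat \<Rightarrow> real. w j) w"
        using continuous_on_product_coordinates[of j] by (metis continuous_on_eq_continuous_at open_UNIV UNIV_I)
      then show ?thesis
        using \<open>W \<longlonglongrightarrow> w\<close> by (rule isCont_tendsto_compose)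
    qed
    then show "(\<lambda>n. mass (W n) i) \<longlonglongrightarrow> mass w i"
      using Bpos[OF \<open>w \<in> B\<close>] that by (intro mass_tendsto) auto
  qed
  define A where "A = B \<inter> (\<Inter>i\<in>{2..N}. B \<inter> (\<lambda>w. mass w i) -` {..g i})"
  have A_iff: "w \<in> A \<longleftrightarrow> w \<in> B \<and> (\<forall>i\<in>{2..N}. mass w i \<le> g i)" for w
    by (auto simp: A_def)
  have "compact A"
    unfolding A_def using \<open>compact B\<close> compact_imp_closed[OF \<open>compact B\<close>] cont
    by (intro compact_Int_closed closed_INT ballI continuous_closed_preimage) auto
  \<comment> \<open>The constraint set is nonempty: for this tuple the cells of index 2 to N are
    empty and have mass 0.\<close>
  moreover have "(\<lambda>i. if i \<in> {2..N} then hi else a') \<in> A" (is "?w \<in> A")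
  proof -
    have "mass ?w i \<le> g i" if i: "i \<in> {2..N}" for i
    proof -
      have i': "i \<in> {1..N}" "1 \<in> {1..N}" using i by auto
      have "x \<notin> cell ?w i" for x
      proof
        assume x: "x \<in> cell ?w i"
        then have xK: "x \<in> S2_closure \<Omega>" using cell_subset by auto
        have "hi * \<delta> \<le> hi * (1 - x \<bullet> m 1)"
          using one_minus_inner_ge[OF xK i'(2)] lo by (intro mult_left_mono) auto
        also have "?w i * (1 - x \<bullet> m 1) \<le> ?w 1 * (1 - x \<bullet> m i)"
          using x i'(2) unfolding cell_def by blast
        then have "hi * (1 - x \<bullet> m 1) \<le> a' * (1 - x \<bullet> m i)"
          using i by simp
        also have "\<dots> \<le> a' * 2"
          using one_minus_inner_le[OF xK i'(1)] a' by (intro mult_left_mono) auto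
        finally have "hi * \<delta> \<le> a' * 2" .
        moreover have "hi * \<delta> = a' * 2 + \<delta>"
          using delta_pos by (simp add: hi_def distrib_right)
        ultimately show False
          using delta_pos by simp
      qed
      then show ?thesis
        using cell_nonempty[of ?w i] g[OF i'(1)] by force
    qed
    then show ?thesis
      using lo by (auto simp: A_iff B_iff)
  qed
  then have "A \<noteq> {}" by auto
  moreover have "continuous_on A (\<lambda>w. \<Sum>i=2..N. w i)"
    by (intro continuous_on_sum continuous_on_subset[OF continuous_on_product_coordinates]) auto
  ultimately have "\<exists>w\<in>A. \<forall>v\<in>A. (\<Sum>i=2..N. w i) \<le> (\<Sum>i=2..N. v i)"
    by (rule continuous_attains_inf)
  then obtain w where w: "w \<in> A" and min: "\<And>v. v \<in> A \<Longrightarrow> (\<Sum>i=2..N. w i) \<le> (\<Sum>i=2..N. v i)"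
    by blast
  have wB: "w \<in> B" and w1: "w 1 = a'"
    using w by (auto simp: A_iff B_iff)
  have "mass w i = g i" if i: "i \<in> {2..N}" for i
  proof (rule ccontr)
    assume "mass w i \<noteq> g i"
    then have lt: "mass w i < g i"
      using w i unfolding A_iff by (simp add: order.strict_iff_order)
    have i': "i \<in> {1..N}" using i by auto
    \<comment> \<open>The i-th parameter is multiplied by 1 - 1/(n+2); the shift by 2 keeps it
      positive already for n = 0.\<close>
    define V where "V n = w(i := w i - w i * inverse (real (Suc (Suc n))))" for n
    have "(\<lambda>n. inverse (real (Suc (Suc n)))) \<longlonglongrightarrow> 0"
      using LIMSEQ_inverse_real_of_nat by (rule LIMSEQ_Suc)
    then have "(\<lambda>n. w i - w i * inverse (real (Suc (Suc n)))) \<longlonglongrightarrow> w i - w i * 0"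
      by (intro tendsto_intros)
    then have "(\<lambda>n. V n j) \<longlonglongrightarrow> w j" for j
      by (cases "j = i") (auto simp: V_def)
    then have "(\<lambda>n. mass (V n) i) \<longlonglongrightarrow> mass w i"
      using Bpos[OF wB] i' by (intro mass_tendsto) auto
    then have "\<forall>\<^sub>F n in sequentially. mass (V n) i < g i"
      using lt by (rule order_tendstoD)
    then obtain n where n: "mass (V n) i < g i"
      by (auto simp: eventually_sequentially)
    define v where "v = V n"
    have vi: "0 < v i" "v i < w i"
      using Bpos[OF wB, of i] by (auto simp: v_def V_def field_simps intro: add_pos_nonneg)
    have vj: "v j = w j" if "j \<noteq> i" for j
      using that by (simp add: v_def V_def)
    have v1: "v 1 = a'"
      using i w1 vj[of 1] by simp
    have vpos: "v j > 0" for j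
      using vi vj Bpos[OF wB, of j] by (cases "j = i") auto
    have vle: "v j \<le> w j" for j
      using vi vj by (cases "j = i") auto
    have vmass: "mass v j \<le> g j" if j: "j \<in> {2..N}" for j
    proof (cases "j = i")
      case True
      then show ?thesis using n by (simp add: v_def)
    next
      case False
      have "mass v j \<le> mass w j"
        using j vj[OF False] vle by (intro mass_mono) auto
      also have "\<dots> \<le> g j"
        using w j unfolding A_iff by blast
      finally show ?thesis .
    qed
    \<comment> \<open>The lowered tuple cannot leave the box through its lower face: it still obeys
      the mass constraints and has first entry a', so the a priori bound applies to it.\<close>
    have vlo: "v j \<ge> lo" if "j \<in> {1..N}" for j
    proof -
      have "v j \<ge> v 1 * \<delta> / 2"
      proof (rule admissible_lower_bounds(2))
        show "1 / reflector_const (v 1) \<delta> * (\<Sum>i=1..N. g i) \<le> (LINT x:S2_closure \<Omega>|surface_measure. f x)"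
          using energy unfolding v1 .
      qed (use vpos g vmass \<open>\<delta> < 1\<close> that in auto)
      then show ?thesis
        by (simp only: v1 lo_def)
    qed
    have "v \<in> B"
      unfolding B_iff
    proof (intro conjI ballI allI impI)
      show "v j \<le> hi" if "j \<in> {2..N}" for j
        using vle[of j] wB that unfolding B_iff by fastforce
      show "v j = a'" if "j \<notin> {2..N}" for j
        using vj[of j] wB that i unfolding B_iff by metis
    qed (use vlo in auto)
    then have "v \<in> A"
      using vmass by (simp add: A_iff)
    then have "(\<Sum>i=2..N. w i) \<le> (\<Sum>i=2..N. v i)"
      by (rule min)
    moreover have "(\<Sum>i=2..N. v i) < (\<Sum>i=2..N. w i)"
      using i vi vle by (intro sum_strict_mono_ex1) auto
    ultimately show False by simp
  qed
  moreover have "w i \<ge> a' * \<delta> / 2" if "i \<in> {1..N}" for i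
    using wB that lo by (cases "i \<in> {2..N}") (auto simp: B_iff lo_def)
  ultimately show ?thesis
    using w1 by (intro that[of w]) auto
qed

end

lemma measure_weighted_dirac:
  assumes "\<And>i. i \<in> {1..N} \<Longrightarrow> g i \<ge> 0"
  shows "measure (weighted_dirac N g m) (m ` {1..N}) = (\<Sum>i=1..N. g i)"
proof -
  have "emeasure (weighted_dirac N g m) (m ` {1..N}) = (\<Sum>i=1..N. ennreal (g i))"
    by (subst emeasure_weighted_dirac) auto
  also have "\<dots> = ennreal (\<Sum>i=1..N. g i)"
    using assms by (intro sum_ennreal) auto
  finally show ?thesis
    using assms by (simp add: measure_def del: atLeastAtMost_iff) (intro enn2real_ennreal sum_nonneg; simp)
qed

theorem theorem7p13:
  fixes \<delta> a a' :: real
    and \<Omega> :: "(real^3) set"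
    and f :: "real^3 \<Rightarrow> real"
    and N :: nat
    and g :: "nat \<Rightarrow> real"
    and m :: "nat \<Rightarrow> real^3"
  assumes "0 < \<delta>" and "\<delta> < 1"
    and "\<Omega> \<subseteq> S2" and "S2_boundary \<Omega> \<in> null_sets surface_measure"
    and "set_integrable surface_measure (S2_closure \<Omega>) f"
    and "AE x in surface_measure. x \<in> S2_closure \<Omega> \<longrightarrow> f x > 0"
    and "N > 1" and "\<And>i. i \<in> {1..N} \<Longrightarrow> g i > 0"
    and "m ` {1..N} \<subseteq> S2" and "inj_on m {1..N}"
    and "\<And>x i. x \<in> S2_closure \<Omega> \<Longrightarrow> i \<in> {1..N} \<Longrightarrow> x \<bullet> m i \<le> 1 - \<delta>"
    and "a > 0" and "a' \<ge> 4 * a / \<delta>"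
    and "(LINT x:S2_closure \<Omega>|surface_measure. f x)
           \<ge> 1 / reflector_const a' \<delta> * measure (weighted_dirac N g m) (m ` {1..N})"
  shows "\<exists>w :: nat \<Rightarrow> real.
      w 1 = a' \<and> (\<forall>i\<in>{1..N}. w i \<ge> 2 * a) \<and>
      (let \<rho> = reflector_radius N m w; \<mu> = reflector_measure \<Omega> f \<rho> in
         S2_closure \<Omega> = (\<Union>i\<in>{1..N}. tau \<Omega> \<rho> (m i)) \<and>
         (\<forall>i\<in>{2..N}. \<mu> {m i} = g i) \<and>
         \<mu> {m 1} > g 1)"
proof -
  interpret reflector \<Omega> f N m \<delta>
  proof
    show "norm (m i) = 1" if "i \<in> {1..N}" for i
      using assms(9) that by (auto simp: image_subset_iff)
  qed (use assms in auto)
  have energy: "1 / reflector_const a' \<delta> * (\<Sum>i=1..N. g i) \<le> (LINT x:S2_closure \<Omega>|surface_measure. f x)"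
    using assms(14) assms(8) by (subst (asm) measure_weighted_dirac) (auto intro: less_imp_le)
  \<comment> \<open>Here a' \<ge> 4 a / \<delta> converts the a priori lower bound into 2 a.\<close>
  have a': "a' > 0" "2 * a \<le> a' * \<delta> / 2"
  proof -
    have "4 * a / \<delta> > 0" using assms(1,12) by simp
    then show "a' > 0" using assms(13) by linarith
    show "2 * a \<le> a' * \<delta> / 2" using assms(1,13) by (simp add: field_simps)
  qed
  obtain w where w: "w 1 = a'" "\<And>i. i \<in> {1..N} \<Longrightarrow> w i \<ge> a' * \<delta> / 2"
      "\<And>i. i \<in> {2..N} \<Longrightarrow> mass w i = g i"
    using ex_prescribed_mass[OF a'(1) assms(2) assms(8) energy] by blast
  have pos: "w i > 0" if "i \<in> {1..N}" for i
    using w(2)[OF that] a' assms(12) by simp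
  have gt: "mass w 1 > g 1"
  proof (rule admissible_lower_bounds(1))
    show "mass w i \<le> g i" if "i \<in> {2..N}" for i
      using w(3)[OF that] by simp
  qed (use pos assms(2,8) energy w(1) in auto)
  \<comment> \<open>A mass of at least g_i > 0 forces a nonempty cell, as the identification with
    the reflector measure demands.\<close>
  have \<mu>: "reflector_measure \<Omega> f (reflector_radius N m w) {m i} = mass w i"
    if "i \<in> {1..N}" "mass w i \<ge> g i" for i
    using that pos assms(8)[OF that(1)] by (intro reflector_measure_eq_mass cell_nonempty) auto
  show ?thesis
    unfolding Let_def
  proof (intro exI conjI ballI)
    show "S2_closure \<Omega> = (\<Union>i\<in>{1..N}. tau \<Omega> (reflector_radius N m w) (m i))"
      using pos by (rule closure_eq_Union_tau)
    show "reflector_measure \<Omega> f (reflector_radius N m w) {m i} = g i" if "i \<in> {2..N}" for i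
      using \<mu>[of i] w(3)[OF that] that by simp
    show "reflector_measure \<Omega> f (reflector_radius N m w) {m 1} > g 1"
      using \<mu>[of 1] gt assms(7) by simp
    show "w i \<ge> 2 * a" if "i \<in> {1..N}" for i
      using w(2)[OF that] a'(2) by simp
  qed (rule w(1))
qed

end
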